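(* Let $\alpha\in\mathcal{CO}_\sigma$ and $\eta\in\mathcal{PCO}_\sigma$. If $\alpha\vdash\eta$, then $\vdash\alpha\supset\eta$. If furthermore $\eta\in\mathcal{CO}_\sigma$, then $\vdash\Pr(\alpha)=\epsilon\to\Pr(\eta)\geq\epsilon$ for every $\epsilon\in[0,1]\cap\mathbb Q$.
   Context: Signature $\sigma=(\mathrm{Dom},\mathrm{Ran})$: a finite nonempty set $\mathrm{Dom}$ of variables with a fixed ordering, and finite nonempty value sets $\mathrm{Ran}(X)$; $\mathbf W_V$ lists $\mathrm{Dom}\setminus\{V\}$ in order, $\mathbf W_{XY}$ lists $\mathrm{Dom}\setminus\{X,Y\}$. $\mathbf X=\mathbf x$ abbreviates $X_1=x_1\wedge\dots\wedge X_n=x_n$; it is consistent unless some variable is assigned two distinct values. Language $\mathcal{CO}_\sigma$: $\alpha::= Y=y\mid Y\neq y\mid\alpha\wedge\alpha\mid\alpha\supset\alpha\mid \mathbf X=\mathbf x\,\Box\!\!\to\alpha$. Abbreviations: $\top:=X=x\,\Box\!\!\to X=x$, $\bot:=X=x\,\Box\!\!\to X\neq x$ (fixed $X,x$), $\neg\alpha:=\alpha\supset\bot$, $\alpha\vee\beta:=\neg(\neg\alpha\wedge\neg\beta)$, $\alpha\equiv\beta:=(\alpha\supset\beta)\wedge(\beta\supset\alpha)$. Language $\mathcal{PCO}_\sigma$: $\varphi::=\eta\mid\varphi\wedge\varphi\mid\varphi\sqcup\varphi\mid\alpha\supset\varphi\mid\mathbf X=\mathbf x\,\Box\!\!\to\varphi$,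 $\alpha\in\mathcal{CO}$, $\eta$ a literal $Y=y$, $Y\neq y$ or a probabilistic atom $\Pr(\alpha)\geq\epsilon$, $\Pr(\alpha)>\epsilon$, $\Pr(\alpha)\geq\Pr(\beta)$, $\Pr(\alpha)>\Pr(\beta)$ ($\epsilon\in[0,1]\cap\mathbb Q$). Abbreviations: $\Pr(\alpha)\leq\epsilon:=\Pr(\neg\alpha)\geq1-\epsilon$; $\Pr(\alpha)<\epsilon:=\Pr(\neg\alpha)>1-\epsilon$; $\Pr(\alpha)=\epsilon:=\Pr(\alpha)\geq\epsilon\wedge\Pr(\alpha)\leq\epsilon$; $\Pr(\alpha)\neq\epsilon:=\Pr(\alpha)>\epsilon\sqcup\Pr(\alpha)<\epsilon$. The operation $\varphi\mapsto\varphi^C$: $(\Pr(\alpha)\geq\epsilon)^C=\Pr(\alpha)<\epsilon$ and vice versa; $(\Pr(\alpha)>\epsilon)^C=\Pr(\alpha)\leq\epsilon$ and vice versa; $(\Pr(\alpha)=\epsilon)^C=\Pr(\alpha)\neq\epsilon$ and vice versa; $(\Pr(\alpha)\geq\Pr(\beta))^C=\Pr(\beta)>\Pr(\alpha)$ and vice versa; $\bot^C=\top$ and vice versa; $(X=x)^C=\Pr(X=x)<1$; $(X\neq x)^C=\Pr(X\neq x)<1$; $(\psi\wedge\chi)^C=\psi^C\sqcup\chi^C$; $(\psi\sqcup\chi)^C=\psi^C\wedge\chi^C$; $(\alpha\supset\chi)^C=\Pr(\alpha)>0\wedge\alpha\supset\chi^C$; $(\mathbf X=\mathbf x\,\Box\!\!\to\chi)^C=\mathbf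 X=\mathbf x\,\Box\!\!\to\chi^C$. $\psi\to\chi:=\psi^C\sqcup\chi$, $\psi\leftrightarrow\chi:=(\psi\to\chi)\wedge(\chi\to\psi)$; $\mathbf Y\neq\mathbf y:=Y_1\neq y_1\sqcup\dots\sqcup Y_n\neq y_n$; $\bigvee,\bigsqcup,\bigwedge$ iterate $\vee,\sqcup,\wedge$. Auxiliary formulas: $\varphi_{DC(X,Y)}:=\bigvee_{x\neq x',\,y\neq y',\,\mathbf w\in\mathrm{Ran}(\mathbf W_{XY})}[((\mathbf W_{XY}=\mathbf w\wedge X=x)\Box\!\!\to Y=y)\wedge((\mathbf W_{XY}=\mathbf w\wedge X=x')\Box\!\!\to Y=y')]$; $\varphi_{End(Y)}:=\bigsqcup_{X\in\mathbf W_Y}\varphi_{DC(X,Y)}$; $X\leadsto Y:=\bigvee_{\mathbf Z\subseteq\mathrm{Dom}\setminus\{X\},\,\mathbf z,\,x\neq x',\,y\neq y'}[((\mathbf Z=\mathbf z\wedge X=x)\Box\!\!\to Y=y)\wedge((\mathbf Z=\mathbf z\wedge X=x')\Box\!\!\to Y=y')]$. Deduction system ($\alpha,\beta$ in $\mathcal{CO}$; $\psi,\chi,\varphi,\theta$ in $\mathcal{PCO}$; $\delta,\epsilon\in[0,1]\cap\mathbb Q$). Axioms: T1: substitution instances of classical tautologies in $\wedge,\sqcup,\to,{}^C,\top,\bot$. T2: $\mathcal{CO}$ instances of classical tautologies in $\wedge,\vee,\supset,\neg,\top,\bot$. P1: $\alpha\leftrightarrow\Pr(\alpha)=1$. P2: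 $\Pr(\alpha)\geq0$. P3: $(\Pr(\alpha)=\delta\wedge\Pr(\beta)=\epsilon\wedge\Pr(\alpha\wedge\beta)=0)\to\Pr(\alpha\vee\beta)=\delta+\epsilon$ ($\delta+\epsilon\leq1$). P3b: $\Pr(\alpha)\geq\epsilon\wedge\Pr(\alpha\wedge\beta)=0\to\Pr(\beta)\leq1-\epsilon$. P4: $\Pr(\alpha)\leq\epsilon\to\Pr(\alpha)<\delta$ ($\delta>\epsilon$). P5: $\Pr(\alpha)<\epsilon\to\Pr(\alpha)\leq\epsilon$. P6: $\Pr(\alpha\equiv\beta)=1\to(\Pr(\alpha)=\epsilon\to\Pr(\beta)=\epsilon)$. P6b: $\Pr(\alpha\supset\beta)=1\to(\Pr(\alpha)=\epsilon\to\Pr(\beta)\geq\epsilon)$. CP1: $(\Pr(\alpha)=\delta\wedge\Pr(\beta)=\epsilon)\to\Pr(\alpha)\geq\Pr(\beta)$ ($\delta\geq\epsilon$). CP2: same with $>$ ($\delta>\epsilon$). O1: $\Pr(\alpha)=0\to(\alpha\supset\psi)$. O1b: $(\alpha\supset\bot)\to\Pr(\alpha)=0$. O2: $(\Pr(\alpha)=\delta\wedge\Pr(\alpha\wedge\beta)=\epsilon)\to(\alpha\supset\Pr(\beta)=\frac{\epsilon}{\delta})$ ($\delta\neq0$). O3: $(\alpha\supset\Pr(\beta)=\epsilon)\to(\Pr(\alpha)=\delta\leftrightarrow\Pr(\alpha\wedge\beta)=\epsilon\cdot\delta)$ ($\epsilon\neq0$). O4: $(\alpha\supset\psi)\to(\alpha\to\psi)$.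 O5$_\wedge$: $\alpha\supset(\psi\wedge\chi)\leftrightarrow(\alpha\supset\psi)\wedge(\alpha\supset\chi)$. O5$_\sqcup$: same with $\sqcup$. O5$_\supset$: $\alpha\supset(\beta\supset\chi)\leftrightarrow(\alpha\wedge\beta)\supset\chi$. A1: $\mathbf Y=\mathbf y\to\mathbf Y\neq\mathbf y'$ ($\mathbf y\neq\mathbf y'$). A2: $X\neq x\leftrightarrow(X=x\supset\bot)$. A3: $\bigvee_{\mathbf y\in\mathrm{Ran}(\mathbf Y)}\mathbf Y=\mathbf y$. C1: $(\mathbf X=\mathbf x\Box\!\!\to(\psi\wedge\chi))\leftrightarrow((\mathbf X=\mathbf x\Box\!\!\to\psi)\wedge(\mathbf X=\mathbf x\Box\!\!\to\chi))$. C2: same with $\sqcup$. C3: $(\mathbf X=\mathbf x\Box\!\!\to(\alpha\supset\chi))\leftrightarrow((\mathbf X=\mathbf x\Box\!\!\to\alpha)\supset(\mathbf X=\mathbf x\Box\!\!\to\chi))$. C4: $(\mathbf X=\mathbf x\Box\!\!\to(\mathbf Y=\mathbf y\Box\!\!\to\chi))\to((\mathbf X'=\mathbf x'\wedge\mathbf Y=\mathbf y)\Box\!\!\to\chi)$, $\mathbf X'=\mathbf X\setminus\mathbf Y$, $\mathbf x'$ corresponding values, $\mathbf X=\mathbf x$ consistent. C4b: $((\mathbf X=\mathbf x\wedge\mathbf Y=\mathbf y)\Box\!\!\to\chi)\to(\mathbf X=\mathbf x\Box\!\!\to(\mathbf Y=\mathbf y\Box\!\!\to\chi))$. C5: $(\mathbf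 X=\mathbf x\Box\!\!\to\bot)\to\psi$ ($\mathbf X=\mathbf x$ consistent). C6: $(\mathbf X=\mathbf x\wedge Y=y)\Box\!\!\to Y=y$. C7: $(\mathbf X=\mathbf x\wedge\gamma)\to(\mathbf X=\mathbf x\Box\!\!\to\gamma)$, $\gamma\in\mathcal{PCO}$ without $\Box\!\!\to$. C8: $(\mathbf X=\mathbf x\Box\!\!\to\Pr(\alpha)\rhd\epsilon)\leftrightarrow\Pr(\mathbf X=\mathbf x\Box\!\!\to\alpha)\rhd\epsilon$ ($\rhd\in\{\geq,>\}$). C8b: $(\mathbf X=\mathbf x\Box\!\!\to\Pr(\alpha)\rhd\Pr(\beta))\leftrightarrow\Pr(\mathbf X=\mathbf x\Box\!\!\to\alpha)\rhd\Pr(\mathbf X=\mathbf x\Box\!\!\to\beta)$. C9: $\varphi_{End(Y)}\to(\mathbf W_Y=\mathbf w\Box\!\!\to\bigsqcup_{y}Y=y)$. C10: $(\varphi_{End(Y)})^C\to(Y=y\supset(\mathbf W_Y=\mathbf w\Box\!\!\to Y=y))$. C11: $(X_1\leadsto X_2\wedge\dots\wedge X_{n-1}\leadsto X_n)\to(X_n\leadsto X_1)^C$ ($n>1$). Rules: MP (from $\psi$, $\psi\to\chi$ infer $\chi$); Rep (from $\vdash\varphi$, $\vdash\theta\leftrightarrow\theta'$ infer $\vdash\varphi[\theta'/\theta]$ if well-formed); $\bot^\omega$ (from $\psi\to\Pr(\alpha)\neq\epsilon$ for all $\epsilon\in[0,1]\cap\mathbb Q$ infer $\psi\to\bot$); Mon$_\supset$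 (from $\vdash\psi\to\chi$ infer $\vdash(\alpha\supset\psi)\to(\alpha\supset\chi)$); $\to$to$\supset$ (from $\vdash\alpha\to\psi$ infer $\vdash\alpha\supset\psi$); $\supset^\omega$ (from $\psi\to(\Pr(\alpha\wedge\beta)=\delta\epsilon\leftrightarrow\Pr(\alpha)=\epsilon)$ for all $\epsilon\in(0,1]\cap\mathbb Q$ infer $\psi\to(\alpha\supset\Pr(\beta)=\delta)$); Mon$_{\Box\!\to}$ (from $\vdash\psi\to\chi$ infer $\vdash(\mathbf X=\mathbf x\Box\!\!\to\psi)\to(\mathbf X=\mathbf x\Box\!\!\to\chi)$). $\Gamma\vdash\varphi$ iff there is a sequence indexed by ordinals $\leq\kappa$ (countable) ending in $\varphi$, each term an axiom, in $\Gamma$, or obtained from earlier terms by a rule, where Rep, Mon$_\supset$, Mon$_{\Box\!\to}$, $\to$to$\supset$ apply only to theorems (formulas derivable from $\emptyset$). *)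

theory Defs
  imports Complex_Main
begin

text \<open>
  Raw formulas over variables \<open>'v\<close> and values \<open>'c\<close>. The languages \<open>CO\<close> and \<open>PCO\<close> are carved
  out below. The antecedent \<open>X\<^sub>1 = x\<^sub>1 \<and> \<dots> \<and> X\<^sub>n = x\<^sub>n\<close> of a counterfactual is stored as the list of
  its pairs \<open>(X\<^sub>i, x\<^sub>i)\<close>; the empty list is allowed, since the tuple of all variables other
  than a given one is empty when there is only one variable.
\<close>

datatype ('v, 'c) fm =
    Eq 'v 'c                                  (infix "\<^bold>=" 62)
  | Neq 'v 'c                                 (infix "\<^bold>\<noteq>" 62)
  | PrGe "('v, 'c) fm" rat
  | PrGt "('v, 'c) fm" rat
  | PrGePr "('v, 'c) fm" "('v, 'c) fm"
  | PrGtPr "('v, 'c) fm" "('v, 'c) fm"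
  | Conj "('v, 'c) fm" "('v, 'c) fm"          (infixr "\<^bold>\<and>" 58)
  | Disj "('v, 'c) fm" "('v, 'c) fm"          (infixr "\<^bold>\<squnion>" 56)
  | Imp "('v, 'c) fm" "('v, 'c) fm"           (infixr "\<^bold>\<supset>" 55)
  | Cf "('v \<times> 'c) list" "('v, 'c) fm"         (infixr "\<box>\<rightarrow>" 60)

primrec cf_free :: "('v, 'c) fm \<Rightarrow> bool" where
  "cf_free (X \<^bold>= x) \<longleftrightarrow> True"
| "cf_free (X \<^bold>\<noteq> x) \<longleftrightarrow> True"
| "cf_free (PrGe \<alpha> \<epsilon>) \<longleftrightarrow> cf_free \<alpha>"
| "cf_free (PrGt \<alpha> \<epsilon>) \<longleftrightarrow> cf_free \<alpha>"
| "cf_free (PrGePr \<alpha> \<beta>) \<longleftrightarrow> cf_free \<alpha> \<and> cf_free \<beta>"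
| "cf_free (PrGtPr \<alpha> \<beta>) \<longleftrightarrow> cf_free \<alpha> \<and> cf_free \<beta>"
| "cf_free (\<phi> \<^bold>\<and> \<psi>) \<longleftrightarrow> cf_free \<phi> \<and> cf_free \<psi>"
| "cf_free (\<phi> \<^bold>\<squnion> \<psi>) \<longleftrightarrow> cf_free \<phi> \<and> cf_free \<psi>"
| "cf_free (\<alpha> \<^bold>\<supset> \<phi>) \<longleftrightarrow> cf_free \<alpha> \<and> cf_free \<phi>"
| "cf_free (xs \<box>\<rightarrow> \<phi>) \<longleftrightarrow> False"

definition consistent :: "('v \<times> 'c) list \<Rightarrow> bool" where
  "consistent xs \<longleftrightarrow> (\<forall>X x x'. (X, x) \<in> set xs \<longrightarrow> (X, x') \<in> set xs \<longrightarrow> x = x')"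

abbreviation prob :: "rat \<Rightarrow> bool" where
  "prob \<epsilon> \<equiv> 0 \<le> \<epsilon> \<and> \<epsilon> \<le> 1"

text \<open>Iterated binary connective, nested to the right, with value \<open>e\<close> on the empty list.\<close>

fun iter :: "('a \<Rightarrow> 'a \<Rightarrow> 'a) \<Rightarrow> 'a \<Rightarrow> 'a list \<Rightarrow> 'a" where
  "iter f e [] = e"
| "iter f e [a] = a"
| "iter f e (a # b # as) = f a (iter f e (b # as))"

text \<open>Classical propositional formulas, used to define substitution instances of tautologies.\<close>

datatype pform = PVar nat | PTop | PBot | PNot pform
  | PAnd pform pform | POr pform pform | PImp pform pform

primrec peval :: "(nat \<Rightarrow> bool) \<Rightarrow> pform \<Rightarrow> bool" where
  "peval v (PVar i) \<longleftrightarrow> v i"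
| "peval v PTop \<longleftrightarrow> True"
| "peval v PBot \<longleftrightarrow> False"
| "peval v (PNot p) \<longleftrightarrow> \<not> peval v p"
| "peval v (PAnd p q) \<longleftrightarrow> peval v p \<and> peval v q"
| "peval v (POr p q) \<longleftrightarrow> peval v p \<or> peval v q"
| "peval v (PImp p q) \<longleftrightarrow> (peval v p \<longrightarrow> peval v q)"

definition tautology :: "pform \<Rightarrow> bool" where
  "tautology p \<longleftrightarrow> (\<forall>v. peval v p)"

text \<open>
  The list \<open>Dom\<close> carries the fixed ordering of the variables. The order in which \<open>Ran X\<close> lists its
  values serves only to write out iterated connectives. The pair \<open>X\<^sub>0\<close>, \<open>x\<^sub>0\<close> is the one fixed
  in the definitions of verum and falsum.
\<close>

locale signature =
  fixes Dom :: "'v list" and Ran :: "'v \<Rightarrow> 'c list" and X\<^sub>0 :: 'v and x\<^sub>0 :: 'c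
  assumes Dom_nonempty: "Dom \<noteq> []"
    and Dom_distinct: "distinct Dom"
    and Ran_nonempty: "X \<in> set Dom \<Longrightarrow> Ran X \<noteq> []"
    and Ran_distinct: "X \<in> set Dom \<Longrightarrow> distinct (Ran X)"
    and X\<^sub>0_in_Dom: "X\<^sub>0 \<in> set Dom"
    and x\<^sub>0_in_Ran: "x\<^sub>0 \<in> set (Ran X\<^sub>0)"
begin

definition wf_asg :: "('v \<times> 'c) list \<Rightarrow> bool" where
  "wf_asg xs \<longleftrightarrow> (\<forall>(X, x) \<in> set xs. X \<in> set Dom \<and> x \<in> set (Ran X))"

primrec CO :: "('v, 'c) fm \<Rightarrow> bool" where
  "CO (Y \<^bold>= y) \<longleftrightarrow> Y \<in> set Dom \<and> y \<in> set (Ran Y)"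
| "CO (Y \<^bold>\<noteq> y) \<longleftrightarrow> Y \<in> set Dom \<and> y \<in> set (Ran Y)"
| "CO (PrGe \<alpha> \<epsilon>) \<longleftrightarrow> False"
| "CO (PrGt \<alpha> \<epsilon>) \<longleftrightarrow> False"
| "CO (PrGePr \<alpha> \<beta>) \<longleftrightarrow> False"
| "CO (PrGtPr \<alpha> \<beta>) \<longleftrightarrow> False"
| "CO (\<alpha> \<^bold>\<and> \<beta>) \<longleftrightarrow> CO \<alpha> \<and> CO \<beta>"
| "CO (\<alpha> \<^bold>\<squnion> \<beta>) \<longleftrightarrow> False"
| "CO (\<alpha> \<^bold>\<supset> \<beta>) \<longleftrightarrow> CO \<alpha> \<and> CO \<beta>"
| "CO (xs \<box>\<rightarrow> \<alpha>) \<longleftrightarrow> wf_asg xs \<and> CO \<alpha>"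

primrec PCO :: "('v, 'c) fm \<Rightarrow> bool" where
  "PCO (Y \<^bold>= y) \<longleftrightarrow> Y \<in> set Dom \<and> y \<in> set (Ran Y)"
| "PCO (Y \<^bold>\<noteq> y) \<longleftrightarrow> Y \<in> set Dom \<and> y \<in> set (Ran Y)"
| "PCO (PrGe \<alpha> \<epsilon>) \<longleftrightarrow> CO \<alpha> \<and> prob \<epsilon>"
| "PCO (PrGt \<alpha> \<epsilon>) \<longleftrightarrow> CO \<alpha> \<and> prob \<epsilon>"
| "PCO (PrGePr \<alpha> \<beta>) \<longleftrightarrow> CO \<alpha> \<and> CO \<beta>"
| "PCO (PrGtPr \<alpha> \<beta>) \<longleftrightarrow> CO \<alpha> \<and> CO \<beta>"
| "PCO (\<phi> \<^bold>\<and> \<psi>) \<longleftrightarrow> PCO \<phi> \<and> PCO \<psi>"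
| "PCO (\<phi> \<^bold>\<squnion> \<psi>) \<longleftrightarrow> PCO \<phi> \<and> PCO \<psi>"
| "PCO (\<alpha> \<^bold>\<supset> \<phi>) \<longleftrightarrow> CO \<alpha> \<and> PCO \<phi>"
| "PCO (xs \<box>\<rightarrow> \<phi>) \<longleftrightarrow> wf_asg xs \<and> PCO \<phi>"

lemma CO_imp_PCO: "CO \<alpha> \<Longrightarrow> PCO \<alpha>"
  by (induction \<alpha>) auto

definition top_fm :: "('v, 'c) fm" ("\<^bold>\<top>") where
  "\<^bold>\<top> = [(X\<^sub>0, x\<^sub>0)] \<box>\<rightarrow> X\<^sub>0 \<^bold>= x\<^sub>0"

definition bot_fm :: "('v, 'c) fm" ("\<^bold>\<bottom>") where
  "\<^bold>\<bottom> = [(X\<^sub>0, x\<^sub>0)] \<box>\<rightarrow> X\<^sub>0 \<^bold>\<noteq> x\<^sub>0"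

definition neg :: "('v, 'c) fm \<Rightarrow> ('v, 'c) fm" ("\<^bold>\<not> _" [59] 59) where
  "\<^bold>\<not> \<alpha> = \<alpha> \<^bold>\<supset> \<^bold>\<bottom>"

definition vee :: "('v, 'c) fm \<Rightarrow> ('v, 'c) fm \<Rightarrow> ('v, 'c) fm" (infixr "\<^bold>\<or>" 57) where
  "\<alpha> \<^bold>\<or> \<beta> = \<^bold>\<not> (\<^bold>\<not> \<alpha> \<^bold>\<and> \<^bold>\<not> \<beta>)"

definition equ :: "('v, 'c) fm \<Rightarrow> ('v, 'c) fm \<Rightarrow> ('v, 'c) fm" (infix "\<^bold>\<equiv>" 54) where
  "(\<alpha> \<^bold>\<equiv> \<beta>) = (\<alpha> \<^bold>\<supset> \<beta>) \<^bold>\<and> (\<beta> \<^bold>\<supset> \<alpha>)"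

definition PrLe :: "('v, 'c) fm \<Rightarrow> rat \<Rightarrow> ('v, 'c) fm" where
  "PrLe \<alpha> \<epsilon> = PrGe (\<^bold>\<not> \<alpha>) (1 - \<epsilon>)"

definition PrLt :: "('v, 'c) fm \<Rightarrow> rat \<Rightarrow> ('v, 'c) fm" where
  "PrLt \<alpha> \<epsilon> = PrGt (\<^bold>\<not> \<alpha>) (1 - \<epsilon>)"

definition PrEq :: "('v, 'c) fm \<Rightarrow> rat \<Rightarrow> ('v, 'c) fm" where
  "PrEq \<alpha> \<epsilon> = PrGe \<alpha> \<epsilon> \<^bold>\<and> PrLe \<alpha> \<epsilon>"

definition PrNeq :: "('v, 'c) fm \<Rightarrow> rat \<Rightarrow> ('v, 'c) fm" where
  "PrNeq \<alpha> \<epsilon> = PrGt \<alpha> \<epsilon> \<^bold>\<squnion> PrLt \<alpha> \<epsilon>"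

definition dest_neg :: "('v, 'c) fm \<Rightarrow> ('v, 'c) fm option" where
  "dest_neg \<alpha> = (case \<alpha> of \<beta> \<^bold>\<supset> \<gamma> \<Rightarrow> if \<gamma> = \<^bold>\<bottom> then Some \<beta> else None | _ \<Rightarrow> None)"

text \<open>
  The operation \<open>\<phi> \<mapsto> \<phi>\<^sup>C\<close>. Its clauses overlap, because some of them refer to abbreviations: for
  instance \<open>Pr(\<alpha>) < \<epsilon>\<close> is itself of the form \<open>Pr(\<beta>) > \<delta>\<close>. To obtain a function, a clause for an
  abbreviation (verum, falsum, \<open>Pr(\<alpha>) \<le> \<epsilon>\<close>, \<open>Pr(\<alpha>) < \<epsilon>\<close>, \<open>Pr(\<alpha>) = \<epsilon>\<close>, \<open>Pr(\<alpha>) \<noteq> \<epsilon>\<close>) takes precedence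
  over the clause for the primitive shape into which the abbreviation unfolds.
\<close>

primrec dual :: "('v, 'c) fm \<Rightarrow> ('v, 'c) fm" where
  "dual (X \<^bold>= x) = PrLt (X \<^bold>= x) 1"
| "dual (X \<^bold>\<noteq> x) = PrLt (X \<^bold>\<noteq> x) 1"
| "dual (PrGe \<alpha> \<epsilon>) =
    (case dest_neg \<alpha> of Some \<beta> \<Rightarrow> PrGt \<beta> (1 - \<epsilon>) | None \<Rightarrow> PrLt \<alpha> \<epsilon>)"
| "dual (PrGt \<alpha> \<epsilon>) =
    (case dest_neg \<alpha> of Some \<beta> \<Rightarrow> PrGe \<beta> (1 - \<epsilon>) | None \<Rightarrow> PrLe \<alpha> \<epsilon>)"
| "dual (PrGePr \<alpha> \<beta>) = PrGtPr \<beta> \<alpha>"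
| "dual (PrGtPr \<alpha> \<beta>) = PrGePr \<beta> \<alpha>"
| "dual (\<phi> \<^bold>\<and> \<psi>) =
    (case \<phi> of
      PrGe \<alpha> \<epsilon> \<Rightarrow> if \<psi> = PrLe \<alpha> \<epsilon> then PrNeq \<alpha> \<epsilon> else dual \<phi> \<^bold>\<squnion> dual \<psi>
    | _ \<Rightarrow> dual \<phi> \<^bold>\<squnion> dual \<psi>)"
| "dual (\<phi> \<^bold>\<squnion> \<psi>) =
    (case \<phi> of
      PrGt \<alpha> \<epsilon> \<Rightarrow> if \<psi> = PrLt \<alpha> \<epsilon> then PrEq \<alpha> \<epsilon> else dual \<phi> \<^bold>\<and> dual \<psi>
    | _ \<Rightarrow> dual \<phi> \<^bold>\<and> dual \<psi>)"
| "dual (\<alpha> \<^bold>\<supset> \<chi>) = PrGt \<alpha> 0 \<^bold>\<and> (\<alpha> \<^bold>\<supset> dual \<chi>)"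
| "dual (xs \<box>\<rightarrow> \<chi>) =
    (if xs \<box>\<rightarrow> \<chi> = \<^bold>\<bottom> then \<^bold>\<top> else if xs \<box>\<rightarrow> \<chi> = \<^bold>\<top> then \<^bold>\<bottom> else xs \<box>\<rightarrow> dual \<chi>)"

lemma dual_abbrevs:
  "dual (PrLt \<alpha> \<epsilon>) = PrGe \<alpha> \<epsilon>"
  "dual (PrLe \<alpha> \<epsilon>) = PrGt \<alpha> \<epsilon>"
  "dual (PrEq \<alpha> \<epsilon>) = PrNeq \<alpha> \<epsilon>"
  "dual (PrNeq \<alpha> \<epsilon>) = PrEq \<alpha> \<epsilon>"
  "dual \<^bold>\<bottom> = \<^bold>\<top>"
  "dual \<^bold>\<top> = \<^bold>\<bottom>"
  by (simp_all add: PrLt_def PrLe_def PrEq_def PrNeq_def neg_def dest_neg_def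
      top_fm_def bot_fm_def)

definition imp :: "('v, 'c) fm \<Rightarrow> ('v, 'c) fm \<Rightarrow> ('v, 'c) fm" (infixr "\<^bold>\<rightarrow>" 53) where
  "(\<psi> \<^bold>\<rightarrow> \<chi>) = dual \<psi> \<^bold>\<squnion> \<chi>"

definition iff :: "('v, 'c) fm \<Rightarrow> ('v, 'c) fm \<Rightarrow> ('v, 'c) fm" (infix "\<^bold>\<leftrightarrow>" 52) where
  "(\<psi> \<^bold>\<leftrightarrow> \<chi>) = (\<psi> \<^bold>\<rightarrow> \<chi>) \<^bold>\<and> (\<chi> \<^bold>\<rightarrow> \<psi>)"

abbreviation conjs :: "('v, 'c) fm list \<Rightarrow> ('v, 'c) fm" where
  "conjs \<equiv> iter Conj \<^bold>\<top>"

abbreviation disjs :: "('v, 'c) fm list \<Rightarrow> ('v, 'c) fm" where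
  "disjs \<equiv> iter Disj \<^bold>\<bottom>"

abbreviation vees :: "('v, 'c) fm list \<Rightarrow> ('v, 'c) fm" where
  "vees \<equiv> iter vee \<^bold>\<bottom>"

definition eqs :: "('v \<times> 'c) list \<Rightarrow> ('v, 'c) fm" where
  "eqs xs = conjs (map (\<lambda>(X, x). X \<^bold>= x) xs)"

definition neqs :: "('v \<times> 'c) list \<Rightarrow> ('v, 'c) fm" where
  "neqs xs = disjs (map (\<lambda>(X, x). X \<^bold>\<noteq> x) xs)"

definition tuples :: "'v list \<Rightarrow> 'c list list" where
  "tuples Xs = product_lists (map Ran Xs)"

definition W :: "'v \<Rightarrow> 'v list" where
  "W V = filter (\<lambda>X. X \<noteq> V) Dom"

definition W2 :: "'v \<Rightarrow> 'v \<Rightarrow> 'v list" where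
  "W2 X Y = filter (\<lambda>V. V \<noteq> X \<and> V \<noteq> Y) Dom"

text \<open>\<open>varies zs X Y\<close> lists the disjuncts that fix the assignment \<open>zs\<close> and vary \<open>X\<close> and \<open>Y\<close>.\<close>

definition varies :: "('v \<times> 'c) list \<Rightarrow> 'v \<Rightarrow> 'v \<Rightarrow> ('v, 'c) fm list" where
  "varies zs X Y =
    [((zs @ [(X, x)]) \<box>\<rightarrow> Y \<^bold>= y) \<^bold>\<and> ((zs @ [(X, x')]) \<box>\<rightarrow> Y \<^bold>= y').
      x \<leftarrow> Ran X, x' \<leftarrow> Ran X, x \<noteq> x', y \<leftarrow> Ran Y, y' \<leftarrow> Ran Y, y \<noteq> y']"

definition DC :: "'v \<Rightarrow> 'v \<Rightarrow> ('v, 'c) fm" where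
  "DC X Y = vees (concat [varies (zip (W2 X Y) w) X Y. w \<leftarrow> tuples (W2 X Y)])"

definition End :: "'v \<Rightarrow> ('v, 'c) fm" where
  "End Y = disjs [DC X Y. X \<leftarrow> W Y]"

definition leads :: "'v \<Rightarrow> 'v \<Rightarrow> ('v, 'c) fm" (infix "\<leadsto>" 62) where
  "X \<leadsto> Y = vees (concat [varies (zip Z z) X Y. Z \<leftarrow> subseqs (W X), z \<leftarrow> tuples Z])"

primrec inst_PCO :: "(nat \<Rightarrow> ('v, 'c) fm) \<Rightarrow> pform \<Rightarrow> ('v, 'c) fm" where
  "inst_PCO s (PVar i) = s i"
| "inst_PCO s PTop = \<^bold>\<top>"
| "inst_PCO s PBot = \<^bold>\<bottom>"
| "inst_PCO s (PNot p) = dual (inst_PCO s p)"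
| "inst_PCO s (PAnd p q) = inst_PCO s p \<^bold>\<and> inst_PCO s q"
| "inst_PCO s (POr p q) = inst_PCO s p \<^bold>\<squnion> inst_PCO s q"
| "inst_PCO s (PImp p q) = (inst_PCO s p \<^bold>\<rightarrow> inst_PCO s q)"

primrec inst_CO :: "(nat \<Rightarrow> ('v, 'c) fm) \<Rightarrow> pform \<Rightarrow> ('v, 'c) fm" where
  "inst_CO s (PVar i) = s i"
| "inst_CO s PTop = \<^bold>\<top>"
| "inst_CO s PBot = \<^bold>\<bottom>"
| "inst_CO s (PNot p) = \<^bold>\<not> inst_CO s p"
| "inst_CO s (PAnd p q) = inst_CO s p \<^bold>\<and> inst_CO s q"
| "inst_CO s (POr p q) = inst_CO s p \<^bold>\<or> inst_CO s q"
| "inst_CO s (PImp p q) = inst_CO s p \<^bold>\<supset> inst_CO s q"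

inductive is_axiom :: "('v, 'c) fm \<Rightarrow> bool" where
  T1: "tautology p \<Longrightarrow> (\<And>i. PCO (s i)) \<Longrightarrow> is_axiom (inst_PCO s p)"
| T2: "tautology p \<Longrightarrow> (\<And>i. CO (s i)) \<Longrightarrow> is_axiom (inst_CO s p)"
| P1: "CO \<alpha> \<Longrightarrow> is_axiom (\<alpha> \<^bold>\<leftrightarrow> PrEq \<alpha> 1)"
| P2: "CO \<alpha> \<Longrightarrow> is_axiom (PrGe \<alpha> 0)"
| P3: "CO \<alpha> \<Longrightarrow> CO \<beta> \<Longrightarrow> prob \<delta> \<Longrightarrow> prob \<epsilon> \<Longrightarrow> \<delta> + \<epsilon> \<le> 1 \<Longrightarrow>
    is_axiom (PrEq \<alpha> \<delta> \<^bold>\<and> PrEq \<beta> \<epsilon> \<^bold>\<and> PrEq (\<alpha> \<^bold>\<and> \<beta>) 0 \<^bold>\<rightarrow> PrEq (\<alpha> \<^bold>\<or> \<beta>) (\<delta> + \<epsilon>))"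
| P3b: "CO \<alpha> \<Longrightarrow> CO \<beta> \<Longrightarrow> prob \<epsilon> \<Longrightarrow>
    is_axiom (PrGe \<alpha> \<epsilon> \<^bold>\<and> PrEq (\<alpha> \<^bold>\<and> \<beta>) 0 \<^bold>\<rightarrow> PrLe \<beta> (1 - \<epsilon>))"
| P4: "CO \<alpha> \<Longrightarrow> prob \<delta> \<Longrightarrow> prob \<epsilon> \<Longrightarrow> \<delta> > \<epsilon> \<Longrightarrow> is_axiom (PrLe \<alpha> \<epsilon> \<^bold>\<rightarrow> PrLt \<alpha> \<delta>)"
| P5: "CO \<alpha> \<Longrightarrow> prob \<epsilon> \<Longrightarrow> is_axiom (PrLt \<alpha> \<epsilon> \<^bold>\<rightarrow> PrLe \<alpha> \<epsilon>)"
| P6: "CO \<alpha> \<Longrightarrow> CO \<beta> \<Longrightarrow> prob \<epsilon> \<Longrightarrow>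
    is_axiom (PrEq (\<alpha> \<^bold>\<equiv> \<beta>) 1 \<^bold>\<rightarrow> (PrEq \<alpha> \<epsilon> \<^bold>\<rightarrow> PrEq \<beta> \<epsilon>))"
| P6b: "CO \<alpha> \<Longrightarrow> CO \<beta> \<Longrightarrow> prob \<epsilon> \<Longrightarrow>
    is_axiom (PrEq (\<alpha> \<^bold>\<supset> \<beta>) 1 \<^bold>\<rightarrow> (PrEq \<alpha> \<epsilon> \<^bold>\<rightarrow> PrGe \<beta> \<epsilon>))"
| CP1: "CO \<alpha> \<Longrightarrow> CO \<beta> \<Longrightarrow> prob \<delta> \<Longrightarrow> prob \<epsilon> \<Longrightarrow> \<delta> \<ge> \<epsilon> \<Longrightarrow>
    is_axiom (PrEq \<alpha> \<delta> \<^bold>\<and> PrEq \<beta> \<epsilon> \<^bold>\<rightarrow> PrGePr \<alpha> \<beta>)"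
| CP2: "CO \<alpha> \<Longrightarrow> CO \<beta> \<Longrightarrow> prob \<delta> \<Longrightarrow> prob \<epsilon> \<Longrightarrow> \<delta> > \<epsilon> \<Longrightarrow>
    is_axiom (PrEq \<alpha> \<delta> \<^bold>\<and> PrEq \<beta> \<epsilon> \<^bold>\<rightarrow> PrGtPr \<alpha> \<beta>)"
| O1: "CO \<alpha> \<Longrightarrow> PCO \<psi> \<Longrightarrow> is_axiom (PrEq \<alpha> 0 \<^bold>\<rightarrow> (\<alpha> \<^bold>\<supset> \<psi>))"
| O1b: "CO \<alpha> \<Longrightarrow> is_axiom ((\<alpha> \<^bold>\<supset> \<^bold>\<bottom>) \<^bold>\<rightarrow> PrEq \<alpha> 0)"
| O2: "CO \<alpha> \<Longrightarrow> CO \<beta> \<Longrightarrow> prob \<delta> \<Longrightarrow> prob \<epsilon> \<Longrightarrow> \<delta> \<noteq> 0 \<Longrightarrow> prob (\<epsilon> / \<delta>) \<Longrightarrow>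
    is_axiom (PrEq \<alpha> \<delta> \<^bold>\<and> PrEq (\<alpha> \<^bold>\<and> \<beta>) \<epsilon> \<^bold>\<rightarrow> (\<alpha> \<^bold>\<supset> PrEq \<beta> (\<epsilon> / \<delta>)))"
| O3: "CO \<alpha> \<Longrightarrow> CO \<beta> \<Longrightarrow> prob \<delta> \<Longrightarrow> prob \<epsilon> \<Longrightarrow> \<epsilon> \<noteq> 0 \<Longrightarrow>
    is_axiom ((\<alpha> \<^bold>\<supset> PrEq \<beta> \<epsilon>) \<^bold>\<rightarrow> (PrEq \<alpha> \<delta> \<^bold>\<leftrightarrow> PrEq (\<alpha> \<^bold>\<and> \<beta>) (\<epsilon> * \<delta>)))"
| O4: "CO \<alpha> \<Longrightarrow> PCO \<psi> \<Longrightarrow> is_axiom ((\<alpha> \<^bold>\<supset> \<psi>) \<^bold>\<rightarrow> (\<alpha> \<^bold>\<rightarrow> \<psi>))"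
| O5_conj: "CO \<alpha> \<Longrightarrow> PCO \<psi> \<Longrightarrow> PCO \<chi> \<Longrightarrow>
    is_axiom ((\<alpha> \<^bold>\<supset> (\<psi> \<^bold>\<and> \<chi>)) \<^bold>\<leftrightarrow> ((\<alpha> \<^bold>\<supset> \<psi>) \<^bold>\<and> (\<alpha> \<^bold>\<supset> \<chi>)))"
| O5_disj: "CO \<alpha> \<Longrightarrow> PCO \<psi> \<Longrightarrow> PCO \<chi> \<Longrightarrow>
    is_axiom ((\<alpha> \<^bold>\<supset> (\<psi> \<^bold>\<squnion> \<chi>)) \<^bold>\<leftrightarrow> ((\<alpha> \<^bold>\<supset> \<psi>) \<^bold>\<squnion> (\<alpha> \<^bold>\<supset> \<chi>)))"
| O5_imp: "CO \<alpha> \<Longrightarrow> CO \<beta> \<Longrightarrow> PCO \<chi> \<Longrightarrow>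
    is_axiom ((\<alpha> \<^bold>\<supset> (\<beta> \<^bold>\<supset> \<chi>)) \<^bold>\<leftrightarrow> ((\<alpha> \<^bold>\<and> \<beta>) \<^bold>\<supset> \<chi>))"
| A1: "set Ys \<subseteq> set Dom \<Longrightarrow> ys \<in> set (tuples Ys) \<Longrightarrow> ys' \<in> set (tuples Ys) \<Longrightarrow> ys \<noteq> ys' \<Longrightarrow>
    is_axiom (eqs (zip Ys ys) \<^bold>\<rightarrow> neqs (zip Ys ys'))"
| A2: "X \<in> set Dom \<Longrightarrow> x \<in> set (Ran X) \<Longrightarrow>
    is_axiom (X \<^bold>\<noteq> x \<^bold>\<leftrightarrow> (X \<^bold>= x \<^bold>\<supset> \<^bold>\<bottom>))"
| A3: "set Ys \<subseteq> set Dom \<Longrightarrow> is_axiom (vees [eqs (zip Ys ys). ys \<leftarrow> tuples Ys])"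
| C1: "wf_asg xs \<Longrightarrow> PCO \<psi> \<Longrightarrow> PCO \<chi> \<Longrightarrow>
    is_axiom ((xs \<box>\<rightarrow> (\<psi> \<^bold>\<and> \<chi>)) \<^bold>\<leftrightarrow> ((xs \<box>\<rightarrow> \<psi>) \<^bold>\<and> (xs \<box>\<rightarrow> \<chi>)))"
| C2: "wf_asg xs \<Longrightarrow> PCO \<psi> \<Longrightarrow> PCO \<chi> \<Longrightarrow>
    is_axiom ((xs \<box>\<rightarrow> (\<psi> \<^bold>\<squnion> \<chi>)) \<^bold>\<leftrightarrow> ((xs \<box>\<rightarrow> \<psi>) \<^bold>\<squnion> (xs \<box>\<rightarrow> \<chi>)))"
| C3: "wf_asg xs \<Longrightarrow> CO \<alpha> \<Longrightarrow> PCO \<chi> \<Longrightarrow>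
    is_axiom ((xs \<box>\<rightarrow> (\<alpha> \<^bold>\<supset> \<chi>)) \<^bold>\<leftrightarrow> ((xs \<box>\<rightarrow> \<alpha>) \<^bold>\<supset> (xs \<box>\<rightarrow> \<chi>)))"
| C4: "wf_asg xs \<Longrightarrow> wf_asg ys \<Longrightarrow> consistent xs \<Longrightarrow> PCO \<chi> \<Longrightarrow>
    is_axiom ((xs \<box>\<rightarrow> (ys \<box>\<rightarrow> \<chi>)) \<^bold>\<rightarrow>
      ((filter (\<lambda>(X, x). X \<notin> fst ` set ys) xs @ ys) \<box>\<rightarrow> \<chi>))"
| C4b: "wf_asg xs \<Longrightarrow> wf_asg ys \<Longrightarrow> PCO \<chi> \<Longrightarrow>
    is_axiom (((xs @ ys) \<box>\<rightarrow> \<chi>) \<^bold>\<rightarrow> (xs \<box>\<rightarrow> (ys \<box>\<rightarrow> \<chi>)))"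
| C5: "wf_asg xs \<Longrightarrow> consistent xs \<Longrightarrow> PCO \<psi> \<Longrightarrow> is_axiom ((xs \<box>\<rightarrow> \<^bold>\<bottom>) \<^bold>\<rightarrow> \<psi>)"
| C6: "wf_asg (xs @ [(Y, y)]) \<Longrightarrow> is_axiom ((xs @ [(Y, y)]) \<box>\<rightarrow> Y \<^bold>= y)"
| C7: "wf_asg xs \<Longrightarrow> PCO \<gamma> \<Longrightarrow> cf_free \<gamma> \<Longrightarrow> is_axiom ((eqs xs \<^bold>\<and> \<gamma>) \<^bold>\<rightarrow> (xs \<box>\<rightarrow> \<gamma>))"
| C8_ge: "wf_asg xs \<Longrightarrow> CO \<alpha> \<Longrightarrow> prob \<epsilon> \<Longrightarrow>
    is_axiom ((xs \<box>\<rightarrow> PrGe \<alpha> \<epsilon>) \<^bold>\<leftrightarrow> PrGe (xs \<box>\<rightarrow> \<alpha>) \<epsilon>)"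
| C8_gt: "wf_asg xs \<Longrightarrow> CO \<alpha> \<Longrightarrow> prob \<epsilon> \<Longrightarrow>
    is_axiom ((xs \<box>\<rightarrow> PrGt \<alpha> \<epsilon>) \<^bold>\<leftrightarrow> PrGt (xs \<box>\<rightarrow> \<alpha>) \<epsilon>)"
| C8b_ge: "wf_asg xs \<Longrightarrow> CO \<alpha> \<Longrightarrow> CO \<beta> \<Longrightarrow>
    is_axiom ((xs \<box>\<rightarrow> PrGePr \<alpha> \<beta>) \<^bold>\<leftrightarrow> PrGePr (xs \<box>\<rightarrow> \<alpha>) (xs \<box>\<rightarrow> \<beta>))"
| C8b_gt: "wf_asg xs \<Longrightarrow> CO \<alpha> \<Longrightarrow> CO \<beta> \<Longrightarrow>
    is_axiom ((xs \<box>\<rightarrow> PrGtPr \<alpha> \<beta>) \<^bold>\<leftrightarrow> PrGtPr (xs \<box>\<rightarrow> \<alpha>) (xs \<box>\<rightarrow> \<beta>))"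
| C9: "Y \<in> set Dom \<Longrightarrow> w \<in> set (tuples (W Y)) \<Longrightarrow>
    is_axiom (End Y \<^bold>\<rightarrow> (zip (W Y) w \<box>\<rightarrow> disjs [Y \<^bold>= y. y \<leftarrow> Ran Y]))"
| C10: "Y \<in> set Dom \<Longrightarrow> y \<in> set (Ran Y) \<Longrightarrow> w \<in> set (tuples (W Y)) \<Longrightarrow>
    is_axiom (dual (End Y) \<^bold>\<rightarrow> (Y \<^bold>= y \<^bold>\<supset> (zip (W Y) w \<box>\<rightarrow> Y \<^bold>= y)))"
| C11: "set Xs \<subseteq> set Dom \<Longrightarrow> length Xs > 1 \<Longrightarrow>
    is_axiom (conjs (map2 leads (butlast Xs) (tl Xs)) \<^bold>\<rightarrow> dual (last Xs \<leadsto> hd Xs))"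

text \<open>
  \<open>repl \<theta> \<theta>' \<phi> \<phi>'\<close>: \<open>\<phi>'\<close> arises from \<open>\<phi>\<close> by replacing occurrences of \<open>\<theta>\<close> by \<open>\<theta>'\<close>. The antecedent of a
  counterfactual counts as the conjunction that it stands for.
\<close>

inductive repl :: "('v, 'c) fm \<Rightarrow> ('v, 'c) fm \<Rightarrow> ('v, 'c) fm \<Rightarrow> ('v, 'c) fm \<Rightarrow> bool"
  for \<theta> \<theta>' where
  "repl \<theta> \<theta>' \<theta> \<theta>'"
| "repl \<theta> \<theta>' \<phi> \<phi>"
| "repl \<theta> \<theta>' \<alpha> \<alpha>' \<Longrightarrow> repl \<theta> \<theta>' (PrGe \<alpha> \<epsilon>) (PrGe \<alpha>' \<epsilon>)"
| "repl \<theta> \<theta>' \<alpha> \<alpha>' \<Longrightarrow> repl \<theta> \<theta>' (PrGt \<alpha> \<epsilon>) (PrGt \<alpha>' \<epsilon>)"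
| "repl \<theta> \<theta>' \<alpha> \<alpha>' \<Longrightarrow> repl \<theta> \<theta>' \<beta> \<beta>' \<Longrightarrow> repl \<theta> \<theta>' (PrGePr \<alpha> \<beta>) (PrGePr \<alpha>' \<beta>')"
| "repl \<theta> \<theta>' \<alpha> \<alpha>' \<Longrightarrow> repl \<theta> \<theta>' \<beta> \<beta>' \<Longrightarrow> repl \<theta> \<theta>' (PrGtPr \<alpha> \<beta>) (PrGtPr \<alpha>' \<beta>')"
| "repl \<theta> \<theta>' \<phi> \<phi>' \<Longrightarrow> repl \<theta> \<theta>' \<psi> \<psi>' \<Longrightarrow> repl \<theta> \<theta>' (\<phi> \<^bold>\<and> \<psi>) (\<phi>' \<^bold>\<and> \<psi>')"
| "repl \<theta> \<theta>' \<phi> \<phi>' \<Longrightarrow> repl \<theta> \<theta>' \<psi> \<psi>' \<Longrightarrow> repl \<theta> \<theta>' (\<phi> \<^bold>\<squnion> \<psi>) (\<phi>' \<^bold>\<squnion> \<psi>')"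
| "repl \<theta> \<theta>' \<alpha> \<alpha>' \<Longrightarrow> repl \<theta> \<theta>' \<psi> \<psi>' \<Longrightarrow> repl \<theta> \<theta>' (\<alpha> \<^bold>\<supset> \<psi>) (\<alpha>' \<^bold>\<supset> \<psi>')"
| "repl \<theta> \<theta>' (eqs xs) (eqs xs') \<Longrightarrow> repl \<theta> \<theta>' \<psi> \<psi>' \<Longrightarrow>
    repl \<theta> \<theta>' (xs \<box>\<rightarrow> \<psi>) (xs' \<box>\<rightarrow> \<psi>')"

text \<open>
  \<open>step T S \<phi>\<close>: a rule yields \<open>\<phi>\<close> from premises in \<open>S\<close>. The rules for theorems only also require
  their premises to be in \<open>T\<close>.
\<close>

inductive step :: "('v, 'c) fm set \<Rightarrow> ('v, 'c) fm set \<Rightarrow> ('v, 'c) fm \<Rightarrow> bool"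
  for T S where
  MP: "\<psi> \<in> S \<Longrightarrow> (\<psi> \<^bold>\<rightarrow> \<chi>) \<in> S \<Longrightarrow> step T S \<chi>"
| Rep: "\<phi> \<in> S \<inter> T \<Longrightarrow> PCO \<theta> \<Longrightarrow> PCO \<theta>' \<Longrightarrow> (\<theta> \<^bold>\<leftrightarrow> \<theta>') \<in> S \<inter> T \<Longrightarrow> repl \<theta> \<theta>' \<phi> \<phi>' \<Longrightarrow> PCO \<phi>' \<Longrightarrow>
    step T S \<phi>'"
| Bot_omega: "PCO \<psi> \<Longrightarrow> CO \<alpha> \<Longrightarrow> (\<And>\<epsilon>. prob \<epsilon> \<Longrightarrow> (\<psi> \<^bold>\<rightarrow> PrNeq \<alpha> \<epsilon>) \<in> S) \<Longrightarrow>
    step T S (\<psi> \<^bold>\<rightarrow> \<^bold>\<bottom>)"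
| Mon_imp: "CO \<alpha> \<Longrightarrow> PCO \<psi> \<Longrightarrow> PCO \<chi> \<Longrightarrow> (\<psi> \<^bold>\<rightarrow> \<chi>) \<in> S \<inter> T \<Longrightarrow>
    step T S ((\<alpha> \<^bold>\<supset> \<psi>) \<^bold>\<rightarrow> (\<alpha> \<^bold>\<supset> \<chi>))"
| To_imp: "CO \<alpha> \<Longrightarrow> PCO \<psi> \<Longrightarrow> (\<alpha> \<^bold>\<rightarrow> \<psi>) \<in> S \<inter> T \<Longrightarrow> step T S (\<alpha> \<^bold>\<supset> \<psi>)"
| Imp_omega: "PCO \<psi> \<Longrightarrow> CO \<alpha> \<Longrightarrow> CO \<beta> \<Longrightarrow> prob \<delta> \<Longrightarrow>
    (\<And>\<epsilon>. 0 < \<epsilon> \<Longrightarrow> \<epsilon> \<le> 1 \<Longrightarrow> (\<psi> \<^bold>\<rightarrow> (PrEq (\<alpha> \<^bold>\<and> \<beta>) (\<delta> * \<epsilon>) \<^bold>\<leftrightarrow> PrEq \<alpha> \<epsilon>)) \<in> S) \<Longrightarrow>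
    step T S (\<psi> \<^bold>\<rightarrow> (\<alpha> \<^bold>\<supset> PrEq \<beta> \<delta>))"
| Mon_cf: "wf_asg xs \<Longrightarrow> PCO \<psi> \<Longrightarrow> PCO \<chi> \<Longrightarrow> (\<psi> \<^bold>\<rightarrow> \<chi>) \<in> S \<inter> T \<Longrightarrow>
    step T S ((xs \<box>\<rightarrow> \<psi>) \<^bold>\<rightarrow> (xs \<box>\<rightarrow> \<chi>))"

text \<open>
  A derivation is a sequence indexed by the ordinals up to some countable \<open>\<kappa>\<close>. Such an index set is
  represented by a well-order \<open>r\<close> on a set of natural numbers with a greatest element \<open>m\<close>.
\<close>

definition derivation ::
  "('v, 'c) fm set \<Rightarrow> ('v, 'c) fm set \<Rightarrow> nat rel \<Rightarrow> (nat \<Rightarrow> ('v, 'c) fm) \<Rightarrow> bool" where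
  "derivation T \<Gamma> r f \<longleftrightarrow> Well_order r \<and>
    (\<forall>i \<in> Field r. PCO (f i) \<and>
      (is_axiom (f i) \<or> f i \<in> \<Gamma> \<or> step T (f ` underS r i) (f i)))"

definition derivable :: "('v, 'c) fm set \<Rightarrow> ('v, 'c) fm set \<Rightarrow> ('v, 'c) fm \<Rightarrow> bool" where
  "derivable T \<Gamma> \<phi> \<longleftrightarrow> (\<exists>r f m. derivation T \<Gamma> r f \<and>
    m \<in> Field r \<and> (\<forall>i \<in> Field r. (i, m) \<in> r) \<and> f m = \<phi>)"

text \<open>
  In a derivation from no premises every entry is a theorem, so there the restriction of some rules
  to theorems is void; this makes the following two definitions non-circular.
\<close>

definition Theorems :: "('v, 'c) fm set" where
  "Theorems = {\<phi>. derivable UNIV {} \<phi>}"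

definition derives :: "('v, 'c) fm set \<Rightarrow> ('v, 'c) fm \<Rightarrow> bool" (infix "\<^bold>\<turnstile>" 51) where
  "\<Gamma> \<^bold>\<turnstile> \<phi> \<longleftrightarrow> derivable Theorems \<Gamma> \<phi>"

lemma derivation_initial:
  assumes d: "derivation T \<Gamma> r f" and i: "i \<in> Field r"
  shows "derivable T \<Gamma> (f i)"
proof -
  let ?r = "Restr r (under r i)"
  have wo: "Well_order r" using d by (simp add: derivation_def)
  then have tr: "trans r" and refl: "refl_on (Field r) r"
    by (auto simp: order_on_defs)
  have sub: "under r i \<subseteq> Field r" by (auto simp: under_def Field_def)
  have i_under: "i \<in> under r i" using i refl by (auto simp: under_def refl_on_def)
  have F: "Field ?r = under r i"
    using sub refl by (auto simp: Field_def under_def refl_on_def)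
  have us: "underS ?r j = underS r j" if "j \<in> under r i" for j
    using that tr by (auto simp: underS_def under_def dest: transD)
  have "well_order_on (under r i) ?r"
    using Well_order_Restr[OF wo, of "under r i"] unfolding F .
  then have "derivation T \<Gamma> ?r f"
    unfolding derivation_def F using d sub us by (auto simp: derivation_def)
  moreover have "\<forall>j \<in> under r i. (j, i) \<in> ?r"
    using i_under by (auto simp: under_def)
  ultimately show ?thesis unfolding derivable_def using F i_under by blast
qed

lemma step_mono: "step T S \<phi> \<Longrightarrow> S \<inter> T \<subseteq> T' \<Longrightarrow> step T' S \<phi>"
  by (erule step.cases) (auto intro: step.intros)

lemma derives_empty_iff: "{} \<^bold>\<turnstile> \<phi> \<longleftrightarrow> \<phi> \<in> Theorems"
proof -
  have "derivation Theorems {} r f" if d: "derivation UNIV {} r f" for r f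
  proof -
    have "f ` underS r i \<subseteq> Theorems" for i
      using derivation_initial[OF d]
      by (auto simp: Theorems_def underS_def Field_def)
    then have "step Theorems (f ` underS r i) \<phi>" if "step UNIV (f ` underS r i) \<phi>" for i \<phi>
      using step_mono[OF that] by simp
    then show ?thesis using d by (auto simp: derivation_def)
  qed
  moreover have "derivation UNIV {} r f" if "derivation Theorems {} r f" for r f
    using that step_mono[where T' = UNIV] by (auto simp: derivation_def)
  ultimately show ?thesis
    unfolding derives_def Theorems_def derivable_def mem_Collect_eq by blast
qed

end

end

theory Submission
  imports Defs "HOL-Library.Countable_Set"
begin

text \<open>
  The deduction theorem holds for \<open>\<rightarrow>\<close> and a single premise: by induction along a derivation of \<open>\<eta>\<close>
  from \<open>\<alpha>\<close>, every entry \<open>\<phi>\<close> satisfies \<open>\<turnstile> \<alpha> \<rightarrow> \<phi>\<close>. The rules restricted to theorems yield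
  theorems, and in the rules with a side formula \<open>\<psi>\<close> one replaces \<open>\<psi>\<close> by \<open>\<alpha> \<and> \<psi>\<close>. Since \<open>\<alpha>\<close> is in
  \<open>CO\<close>, the rule from \<open>\<rightarrow>\<close> to \<open>\<supset>\<close> turns \<open>\<turnstile> \<alpha> \<rightarrow> \<eta>\<close> into \<open>\<turnstile> \<alpha> \<supset> \<eta>\<close>, and then P1 and P6b give the claim
  on probabilities. The infinitary rules require that countably many derivations can be concatenated
  into one.
\<close>

section \<open>Well-orders given by their strict part\<close>

text \<open>Well-foundedness makes \<open>L\<close> asymmetric. This gives antisymmetry of the
  reflexive closure \<open>R\<close> and identifies the strict predecessors in \<open>R\<close> with
  the \<open>L\<close>-predecessors inside \<open>A\<close>, which are the entries a rule may
  cite.\<close>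

lemma well_order_of_strict:
  assumes "wf L" "trans L" "total_on A L"
  defines "R \<equiv> {(x, y). x \<in> A \<and> y \<in> A \<and> (x = y \<or> (x, y) \<in> L)}"
  shows "Well_order R" "Field R = A" "underS R x = {y \<in> A. x \<in> A \<and> (y, x) \<in> L}"
proof -
  show F: "Field R = A" by (auto simp: R_def Field_def)
  have asym: "(y, x) \<notin> L" if "(x, y) \<in> L" for x y
    using assms(1) that by (rule wf_not_sym)
  then show "underS R x = {y \<in> A. x \<in> A \<and> (y, x) \<in> L}"
    by (auto simp: underS_def R_def)
  have "refl_on A R" by (auto simp: R_def refl_on_def)
  moreover have "trans R" using assms(2) by (auto simp: R_def trans_def)
  moreover have "antisym R" using asym by (auto simp: R_def antisym_def)
  moreover have "total_on A R" using assms(3) by (auto simp: R_def total_on_def)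
  moreover have "wf (R - Id)" by (rule wf_subset[OF assms(1)]) (auto simp: R_def)
  moreover have "R \<subseteq> A \<times> A" by (auto simp: R_def)
  ultimately show "Well_order R"
    unfolding F by (simp add: order_on_defs)
qed

lemma well_order_on_singleton [simp]: "well_order_on {a} {(a, a)}"
proof -
  have "{(a, a)} - Id = {}" by auto
  then show ?thesis
    by (simp add: order_on_defs refl_on_def antisym_def trans_def)
qed

context signature
begin

section \<open>Concatenation of derivations\<close>

lemma step_mono_premises: "step T S \<phi> \<Longrightarrow> S \<subseteq> S' \<Longrightarrow> step T S' \<phi>"
  by (erule step.cases) (auto intro: step.intros)

text \<open>This is the ordinal sum of the well-orders \<open>r n\<close>, moved to the naturals by
  \<open>prod_encode\<close>. An entry of block \<open>n\<close> may cite every earlier block, so a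
  block can continue the previous ones. The sum may lack a greatest element, so the result is a
  \<open>derivation\<close> together with its set of entries.\<close>

lemma derivation_concat:
  fixes r :: "nat \<Rightarrow> nat rel" and f :: "nat \<Rightarrow> nat \<Rightarrow> ('v, 'c) fm"
  assumes wo: "\<And>n. Well_order (r n)"
    and entry: "\<And>n a. a \<in> Field (r n) \<Longrightarrow> PCO (f n a) \<and> (is_axiom (f n a) \<or> f n a \<in> \<Gamma> \<or>
      step T ((\<Union>k<n. f k ` Field (r k)) \<union> f n ` underS (r n) a) (f n a))"
  obtains R g where "derivation T \<Gamma> R g" "g ` Field R = (\<Union>n. f n ` Field (r n))"
proof -
  \<comment> \<open>\<open>P\<close> compares block numbers first and uses the strict part of
    \<open>r n\<close> inside block \<open>n\<close>; \<open>L\<close> is its copy on codes of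
    pairs.\<close>
  define P where "P = {((n, a), (m, b)). n < m \<or> n = m \<and> (a, b) \<in> r n - Id}"
  define L where "L = inv_image P prod_decode"
  define A where "A = prod_encode ` (SIGMA n : UNIV. Field (r n))"
  define g where "g = case_prod f \<circ> prod_decode"
  define R where "R = {(x, y). x \<in> A \<and> y \<in> A \<and> (x = y \<or> (x, y) \<in> L)}"
  \<comment> \<open>Well-foundedness of \<open>P\<close> is that of a lexicographic order: the block
    number is the measure, and ties are settled inside one block.\<close>
  have "wf (same_fst (\<lambda>_. True) (\<lambda>n. r n - Id))"
    using wo by (intro wf_same_fst) (auto simp: order_on_defs)
  then have "wf (fst <*mlex*> same_fst (\<lambda>_. True) (\<lambda>n. r n - Id))"
    by (rule wf_mlex)
  then have "wf P"
    by (rule wf_subset) (auto simp: P_def mlex_prod_def same_fst_def)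
  then have wfL: "wf L" by (simp add: L_def)
  have "trans (r n)" "antisym (r n)" for n using wo by (auto simp: order_on_defs)
  then have tr: "trans (r n - Id)" for n by (simp add: trans_diff_Id)
  have "trans P"
  proof (rule transI)
    fix x y z assume "(x, y) \<in> P" "(y, z) \<in> P"
    then show "(x, z) \<in> P"
      using transD[OF tr[of "fst x"], of "snd x" "snd y" "snd z"]
      by (cases x; cases y; cases z) (auto simp: P_def)
  qed
  then have trL: "trans L" by (simp add: L_def trans_inv_image)
  have tot: "total_on (Field (r n)) (r n)" for n using wo by (auto simp: order_on_defs)
  have "(x, y) \<in> L \<or> (y, x) \<in> L" if xy: "x \<in> A" "y \<in> A" "x \<noteq> y" for x y
  proof -
    obtain n a m b where "x = prod_encode (n, a)" "y = prod_encode (m, b)"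
      "a \<in> Field (r n)" "b \<in> Field (r m)"
      using xy by (auto simp: A_def)
    then show ?thesis
      using \<open>x \<noteq> y\<close> tot[of n] by (cases n m rule: linorder_cases) (auto simp: L_def P_def total_on_def)
  qed
  then have totL: "total_on A L" by (simp add: total_on_def)
  note R = well_order_of_strict[OF wfL trL totL, folded R_def]
  have img: "g ` A = (\<Union>n. f n ` Field (r n))"
    by (force simp: A_def g_def image_iff)
  have "PCO (g x) \<and> (is_axiom (g x) \<or> g x \<in> \<Gamma> \<or> step T (g ` underS R x) (g x))" if "x \<in> A" for x
  proof -
    obtain n a where x: "x = prod_encode (n, a)" and a: "a \<in> Field (r n)"
      using \<open>x \<in> A\<close> by (auto simp: A_def)
    \<comment> \<open>All formulas that the entry may cite occur strictly before it in
      \<open>R\<close>, so monotonicity in the premises carries its step over.\<close>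
    have "(\<Union>k<n. f k ` Field (r k)) \<union> f n ` underS (r n) a \<subseteq> g ` underS R x"
    proof
      fix \<phi> assume "\<phi> \<in> (\<Union>k<n. f k ` Field (r k)) \<union> f n ` underS (r n) a"
      then obtain k b where kb: "\<phi> = f k b" "b \<in> Field (r k)" "k < n \<or> k = n \<and> (b, a) \<in> r n - Id"
        by (auto simp: underS_def Field_def)
      then have "prod_encode (k, b) \<in> underS R x"
        using a x by (auto simp: R A_def L_def P_def)
      then show "\<phi> \<in> g ` underS R x"
        using kb(1) by (force simp: g_def image_iff)
    qed
    then show ?thesis
      using entry[OF a] step_mono_premises by (auto simp: x g_def)
  qed
  then have "derivation T \<Gamma> R g" using R(1) by (simp add: derivation_def R(2))
  then show ?thesis using that img R by simp
qed

text \<open>An enumeration of the countable set \<open>S\<close> picks one derivation per premise. A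
  first concatenation contains all of \<open>S\<close>; a second one places \<phi> after it, which
  works even if the first has order type without a last element.\<close>

lemma derivable_step:
  assumes S: "countable S" "S \<noteq> {}" "\<And>\<psi>. \<psi> \<in> S \<Longrightarrow> derivable T \<Gamma> \<psi>"
    and st: "step T S \<phi>" and "PCO \<phi>"
  shows "derivable T \<Gamma> \<phi>"
proof -
  have "\<exists>r f. derivation T \<Gamma> r f \<and> from_nat_into S n \<in> f ` Field r" for n
    using S(3)[OF from_nat_into[OF S(2)], of n] unfolding derivable_def by (metis image_eqI)
  then obtain r f where d: "\<And>n. derivation T \<Gamma> (r n) (f n)"
    and mem: "\<And>n. from_nat_into S n \<in> f n ` Field (r n)"
    by metis
  have "Well_order (r n)" for n using d by (simp add: derivation_def)
  moreover have "PCO (f n a) \<and> (is_axiom (f n a) \<or> f n a \<in> \<Gamma> \<or>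
      step T ((\<Union>k<n. f k ` Field (r k)) \<union> f n ` underS (r n) a) (f n a))"
    if "a \<in> Field (r n)" for n a
    using d[of n] that step_mono_premises[OF _ Un_upper2] by (auto simp: derivation_def)
  ultimately obtain R g where Rg: "derivation T \<Gamma> R g"
    and img: "g ` Field R = (\<Union>n. f n ` Field (r n))"
    by (rule derivation_concat)
  have "range (from_nat_into S) \<subseteq> g ` Field R" using mem unfolding img by blast
  then have "S \<subseteq> g ` Field R" using range_from_nat_into[OF S(2,1)] by simp
  then have st': "step T (g ` Field R) \<phi>" by (rule step_mono_premises[OF st])
  \<comment> \<open>Block 0 is the derivation of all premises, and every later block is the single
    entry \<phi>. The repetitions are harmless, as each copy can cite block 0.\<close>
  define r' where "r' = (\<lambda>n::nat. if n = 0 then R else {(0, 0)})"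
  define f' where "f' = (\<lambda>n::nat. if n = 0 then g else (\<lambda>_. \<phi>))"
  have "Well_order (r' n)" for n
    using Rg by (simp add: r'_def derivation_def)
  moreover have "PCO (f' n a) \<and> (is_axiom (f' n a) \<or> f' n a \<in> \<Gamma> \<or>
      step T ((\<Union>k<n. f' k ` Field (r' k)) \<union> f' n ` underS (r' n) a) (f' n a))"
    if a: "a \<in> Field (r' n)" for n a
  proof (cases "n = 0")
    case True
    then show ?thesis using Rg a by (simp add: derivation_def f'_def r'_def)
  next
    case False
    then have "f' 0 ` Field (r' 0) \<subseteq> (\<Union>k<n. f' k ` Field (r' k))" by blast
    moreover have "f' 0 = g" "r' 0 = R" by (simp_all add: f'_def r'_def)
    ultimately have "g ` Field R \<subseteq> (\<Union>k<n. f' k ` Field (r' k))" by simp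
    then have "step T ((\<Union>k<n. f' k ` Field (r' k)) \<union> X) \<phi>" for X
      by (intro step_mono_premises[OF st'] le_supI1)
    then show ?thesis using False \<open>PCO \<phi>\<close> by (simp add: f'_def)
  qed
  ultimately obtain R' g' where R'g': "derivation T \<Gamma> R' g'"
    and img': "g' ` Field R' = (\<Union>n. f' n ` Field (r' n))"
    by (rule derivation_concat)
  have "0 \<in> Field (r' 1)" "\<phi> = f' 1 0" by (auto simp: r'_def f'_def Field_def)
  then have "\<phi> \<in> g' ` Field R'" unfolding img' by blast
  \<comment> \<open>Cutting the sequence off at an occurrence of \<phi> makes \<phi> its last
    entry.\<close>
  then show ?thesis using derivation_initial[OF R'g'] by auto
qed

lemma derivable_axiom:
  assumes "is_axiom \<phi>" "PCO \<phi>"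
  shows "derivable T \<Gamma> \<phi>"
proof -
  have "derivation T \<Gamma> {(0, 0)} (\<lambda>_. \<phi>)"
    using assms by (simp add: derivation_def)
  then show ?thesis
    using derivation_initial[of T \<Gamma> "{(0, 0)}" "\<lambda>_. \<phi>" 0] by (auto simp: Field_def)
qed

lemma Theorems_axiom: "is_axiom \<phi> \<Longrightarrow> PCO \<phi> \<Longrightarrow> \<phi> \<in> Theorems"
  by (simp add: Theorems_def derivable_axiom)

text \<open>\<open>Theorems\<close> is defined by derivations over \<open>UNIV\<close>, where the
  restriction of rules to theorems is void; hence \<open>UNIV\<close> is the first argument of
  \<open>step\<close>.\<close>

lemma Theorems_step:
  "step UNIV S \<phi> \<Longrightarrow> PCO \<phi> \<Longrightarrow> countable S \<Longrightarrow> S \<noteq> {} \<Longrightarrow> S \<subseteq> Theorems \<Longrightarrow> \<phi> \<in> Theorems"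
  unfolding Theorems_def using derivable_step[of S UNIV "{}" \<phi>] by auto

section \<open>Well-formedness of abbreviations and duals\<close>

lemma CO_bot [simp]: "CO \<^bold>\<bottom>"
  using X\<^sub>0_in_Dom x\<^sub>0_in_Ran by (simp add: bot_fm_def wf_asg_def)

lemma CO_top [simp]: "CO \<^bold>\<top>"
  using X\<^sub>0_in_Dom x\<^sub>0_in_Ran by (simp add: top_fm_def wf_asg_def)

lemmas PCO_bot [simp] = CO_imp_PCO[OF CO_bot]
  and PCO_top [simp] = CO_imp_PCO[OF CO_top]

lemma CO_neg [simp]: "CO (\<^bold>\<not> \<alpha>) \<longleftrightarrow> CO \<alpha>"
  by (simp add: neg_def)

lemma PCO_PrLe [simp]: "PCO (PrLe \<alpha> \<epsilon>) \<longleftrightarrow> CO \<alpha> \<and> prob \<epsilon>"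
  and PCO_PrLt [simp]: "PCO (PrLt \<alpha> \<epsilon>) \<longleftrightarrow> CO \<alpha> \<and> prob \<epsilon>"
  by (auto simp: PrLe_def PrLt_def)

lemma PCO_PrEq [simp]: "PCO (PrEq \<alpha> \<epsilon>) \<longleftrightarrow> CO \<alpha> \<and> prob \<epsilon>"
  and PCO_PrNeq [simp]: "PCO (PrNeq \<alpha> \<epsilon>) \<longleftrightarrow> CO \<alpha> \<and> prob \<epsilon>"
  by (auto simp: PrEq_def PrNeq_def)

lemma dest_neg_SomeD: "dest_neg \<alpha> = Some \<beta> \<Longrightarrow> \<alpha> = \<^bold>\<not> \<beta>"
  by (auto simp: dest_neg_def neg_def split: fm.splits if_splits)

text \<open>The clauses of \<open>dual\<close> for conjunction and disjunction inspect the left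
  component to recognise \<open>PrEq\<close> and \<open>PrNeq\<close>, hence the case split there.
  In the probabilistic atoms, \<open>dest_neg\<close> returns the formula under a negation, which is
  again in \<open>CO\<close>.\<close>

lemma PCO_dual: "PCO \<phi> \<Longrightarrow> PCO (dual \<phi>)"
proof (induction \<phi>)
  case (Conj \<phi> \<psi>)
  then show ?case by (cases \<phi>) auto
next
  case (Disj \<phi> \<psi>)
  then show ?case by (cases \<phi>) auto
qed (auto split: option.split dest: dest_neg_SomeD)

lemma PCO_imp [simp]: "PCO \<phi> \<Longrightarrow> PCO \<psi> \<Longrightarrow> PCO (\<phi> \<^bold>\<rightarrow> \<psi>)"
  by (simp add: imp_def PCO_dual)

lemma PCO_iff [simp]: "PCO \<phi> \<Longrightarrow> PCO \<psi> \<Longrightarrow> PCO (\<phi> \<^bold>\<leftrightarrow> \<psi>)"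
  by (simp add: iff_def)

lemma PCO_inst_PCO: "(\<And>i. PCO (s i)) \<Longrightarrow> PCO (inst_PCO s p)"
  by (induction p) (auto simp: PCO_dual)

section \<open>Propositional reasoning with theorems\<close>

lemma Theorems_MP: "\<psi> \<in> Theorems \<Longrightarrow> (\<psi> \<^bold>\<rightarrow> \<chi>) \<in> Theorems \<Longrightarrow> PCO \<chi> \<Longrightarrow> \<chi> \<in> Theorems"
  by (rule Theorems_step[of "{\<psi>, \<psi> \<^bold>\<rightarrow> \<chi>}"]) (auto intro: step.MP)

lemma Theorems_tautology: "tautology p \<Longrightarrow> (\<And>i. PCO (s i)) \<Longrightarrow> inst_PCO s p \<in> Theorems"
  by (intro Theorems_axiom T1 PCO_inst_PCO)

lemma Theorems_imp_refl:
  assumes "PCO \<phi>" shows "(\<phi> \<^bold>\<rightarrow> \<phi>) \<in> Theorems"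
  using Theorems_tautology[of "PImp (PVar 0) (PVar 0)" "\<lambda>_. \<phi>"] assms
  by (simp add: tautology_def)

lemma Theorems_weaken:
  assumes "\<psi> \<in> Theorems" "PCO \<phi>" "PCO \<psi>" shows "(\<phi> \<^bold>\<rightarrow> \<psi>) \<in> Theorems"
proof -
  have "(\<psi> \<^bold>\<rightarrow> (\<phi> \<^bold>\<rightarrow> \<psi>)) \<in> Theorems"
    using Theorems_tautology[of "PImp (PVar 0) (PImp (PVar 1) (PVar 0))"
        "\<lambda>i. if i = 0 then \<psi> else \<phi>"] assms
    by (simp add: tautology_def)
  with assms show ?thesis by (auto intro: Theorems_MP)
qed

text \<open>Modus ponens under a hypothesis \<phi>, from the tautology that distributes
  \<open>\<rightarrow>\<close> over \<open>\<rightarrow>\<close>.\<close>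

lemma Theorems_imp_MP:
  assumes "(\<phi> \<^bold>\<rightarrow> \<psi>) \<in> Theorems" "(\<phi> \<^bold>\<rightarrow> (\<psi> \<^bold>\<rightarrow> \<chi>)) \<in> Theorems" "PCO \<phi>" "PCO \<psi>" "PCO \<chi>"
  shows "(\<phi> \<^bold>\<rightarrow> \<chi>) \<in> Theorems"
proof -
  have "((\<phi> \<^bold>\<rightarrow> \<psi>) \<^bold>\<rightarrow> ((\<phi> \<^bold>\<rightarrow> (\<psi> \<^bold>\<rightarrow> \<chi>)) \<^bold>\<rightarrow> (\<phi> \<^bold>\<rightarrow> \<chi>))) \<in> Theorems"
    using Theorems_tautology[of "PImp (PImp (PVar 0) (PVar 1))
          (PImp (PImp (PVar 0) (PImp (PVar 1) (PVar 2))) (PImp (PVar 0) (PVar 2)))"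
        "\<lambda>i. if i = 0 then \<phi> else if i = 1 then \<psi> else \<chi>"] assms
    by (simp add: tautology_def)
  with assms show ?thesis by (meson Theorems_MP PCO_imp)
qed

text \<open>Serves the infinitary rules: it merges the hypothesis \<phi> into their side formula
  \<psi> and extracts it afterwards.\<close>

lemma Theorems_uncurry_iff:
  assumes "PCO \<phi>" "PCO \<psi>" "PCO \<chi>"
  shows "(\<phi> \<^bold>\<rightarrow> (\<psi> \<^bold>\<rightarrow> \<chi>)) \<in> Theorems \<longleftrightarrow> (\<phi> \<^bold>\<and> \<psi> \<^bold>\<rightarrow> \<chi>) \<in> Theorems"
proof -
  \<comment> \<open>The variables from index 2 on all receive \<chi>, since T1 asks for a
    \<open>PCO\<close> formula at every index.\<close>
  let ?s = "\<lambda>i::nat. if i = 0 then \<phi> else if i = 1 then \<psi> else \<chi>"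
  let ?p = "PImp (PVar 0) (PImp (PVar 1) (PVar 2))"
  let ?q = "PImp (PAnd (PVar 0) (PVar 1)) (PVar 2)"
  have "((\<phi> \<^bold>\<rightarrow> (\<psi> \<^bold>\<rightarrow> \<chi>)) \<^bold>\<rightarrow> (\<phi> \<^bold>\<and> \<psi> \<^bold>\<rightarrow> \<chi>)) \<in> Theorems"
    using Theorems_tautology[of "PImp ?p ?q" ?s] assms by (simp add: tautology_def)
  moreover have "((\<phi> \<^bold>\<and> \<psi> \<^bold>\<rightarrow> \<chi>) \<^bold>\<rightarrow> (\<phi> \<^bold>\<rightarrow> (\<psi> \<^bold>\<rightarrow> \<chi>))) \<in> Theorems"
    using Theorems_tautology[of "PImp ?q ?p" ?s] assms by (simp add: tautology_def)
  ultimately show ?thesis using assms by (auto intro: Theorems_MP)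
qed

lemma Theorems_iffD1:
  assumes "(\<phi> \<^bold>\<leftrightarrow> \<psi>) \<in> Theorems" "\<phi> \<in> Theorems" "PCO \<phi>" "PCO \<psi>"
  shows "\<psi> \<in> Theorems"
proof -
  have "((\<phi> \<^bold>\<leftrightarrow> \<psi>) \<^bold>\<rightarrow> (\<phi> \<^bold>\<rightarrow> \<psi>)) \<in> Theorems"
    using Theorems_tautology[of "PImp (PAnd (PImp (PVar 0) (PVar 1)) (PImp (PVar 1) (PVar 0)))
          (PImp (PVar 0) (PVar 1))" "\<lambda>i. if i = 0 then \<phi> else \<psi>"] assms
    by (simp add: tautology_def iff_def)
  with assms show ?thesis by (meson Theorems_MP PCO_imp)
qed

section \<open>Closure of the theorems under the rules\<close>

text \<open>The premises are indexed by rationals, so they form a countable set and their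
  derivations can be concatenated.\<close>

lemma Theorems_Bot_omega:
  assumes "PCO \<psi>" "CO \<alpha>" "\<And>\<epsilon>. prob \<epsilon> \<Longrightarrow> (\<psi> \<^bold>\<rightarrow> PrNeq \<alpha> \<epsilon>) \<in> Theorems"
  shows "(\<psi> \<^bold>\<rightarrow> \<^bold>\<bottom>) \<in> Theorems"
proof (rule Theorems_step[of "(\<lambda>\<epsilon>. \<psi> \<^bold>\<rightarrow> PrNeq \<alpha> \<epsilon>) ` {\<epsilon>. prob \<epsilon>}"])
  show "(\<lambda>\<epsilon>. \<psi> \<^bold>\<rightarrow> PrNeq \<alpha> \<epsilon>) ` {\<epsilon>. prob \<epsilon>} \<noteq> {}" by (auto intro: exI[of _ 0])
qed (use assms in \<open>auto intro: step.Bot_omega\<close>)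

lemma Theorems_Imp_omega:
  assumes "PCO \<psi>" "CO \<alpha>" "CO \<beta>" "prob \<delta>"
    and "\<And>\<epsilon>. 0 < \<epsilon> \<Longrightarrow> \<epsilon> \<le> 1 \<Longrightarrow>
      (\<psi> \<^bold>\<rightarrow> (PrEq (\<alpha> \<^bold>\<and> \<beta>) (\<delta> * \<epsilon>) \<^bold>\<leftrightarrow> PrEq \<alpha> \<epsilon>)) \<in> Theorems"
  shows "(\<psi> \<^bold>\<rightarrow> (\<alpha> \<^bold>\<supset> PrEq \<beta> \<delta>)) \<in> Theorems"
proof (rule Theorems_step[of
      "(\<lambda>\<epsilon>. \<psi> \<^bold>\<rightarrow> (PrEq (\<alpha> \<^bold>\<and> \<beta>) (\<delta> * \<epsilon>) \<^bold>\<leftrightarrow> PrEq \<alpha> \<epsilon>)) ` {0<..1}"])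
  show "step UNIV ((\<lambda>\<epsilon>. \<psi> \<^bold>\<rightarrow> (PrEq (\<alpha> \<^bold>\<and> \<beta>) (\<delta> * \<epsilon>) \<^bold>\<leftrightarrow> PrEq \<alpha> \<epsilon>)) ` {0<..1})
    (\<psi> \<^bold>\<rightarrow> (\<alpha> \<^bold>\<supset> PrEq \<beta> \<delta>))"
    using assms by (intro step.Imp_omega) auto
qed (use assms in auto)

lemma Theorems_Rep:
  assumes "\<phi> \<in> Theorems" "PCO \<theta>" "PCO \<theta>'" "(\<theta> \<^bold>\<leftrightarrow> \<theta>') \<in> Theorems" "repl \<theta> \<theta>' \<phi> \<phi>'" "PCO \<phi>'"
  shows "\<phi>' \<in> Theorems"
  using assms by (intro Theorems_step[of "{\<phi>, \<theta> \<^bold>\<leftrightarrow> \<theta>'}"] step.Rep[of \<phi> _ _ \<theta> \<theta>']) auto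

lemma Theorems_Mon_imp:
  assumes "CO \<alpha>" "PCO \<psi>" "PCO \<chi>" "(\<psi> \<^bold>\<rightarrow> \<chi>) \<in> Theorems"
  shows "((\<alpha> \<^bold>\<supset> \<psi>) \<^bold>\<rightarrow> (\<alpha> \<^bold>\<supset> \<chi>)) \<in> Theorems"
  using assms by (intro Theorems_step[of "{\<psi> \<^bold>\<rightarrow> \<chi>}"] step.Mon_imp) auto

lemma Theorems_To_imp:
  assumes "CO \<alpha>" "PCO \<psi>" "(\<alpha> \<^bold>\<rightarrow> \<psi>) \<in> Theorems"
  shows "(\<alpha> \<^bold>\<supset> \<psi>) \<in> Theorems"
  using assms by (intro Theorems_step[of "{\<alpha> \<^bold>\<rightarrow> \<psi>}"] step.To_imp) auto

lemma Theorems_Mon_cf: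
  assumes "wf_asg xs" "PCO \<psi>" "PCO \<chi>" "(\<psi> \<^bold>\<rightarrow> \<chi>) \<in> Theorems"
  shows "((xs \<box>\<rightarrow> \<psi>) \<^bold>\<rightarrow> (xs \<box>\<rightarrow> \<chi>)) \<in> Theorems"
  using assms by (intro Theorems_step[of "{\<psi> \<^bold>\<rightarrow> \<chi>}"] step.Mon_cf) auto

section \<open>The deduction theorem\<close>

text \<open>Each rule survives prefixing \<phi> to its premises and conclusion. \<open>S\<close>
  stands for the earlier entries of a derivation; their membership in \<open>PCO\<close> covers the
  cut formula of \<open>MP\<close>.\<close>

lemma imp_Theorems_step:
  assumes "PCO \<phi>" and st: "step Theorems S \<chi>" and "PCO \<chi>"
    and S: "\<And>\<psi>. \<psi> \<in> S \<Longrightarrow> PCO \<psi> \<and> (\<phi> \<^bold>\<rightarrow> \<psi>) \<in> Theorems"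
  shows "(\<phi> \<^bold>\<rightarrow> \<chi>) \<in> Theorems"
  using st
proof cases
  case (MP \<psi>)
  show ?thesis
    using S[OF MP(1)] S[OF MP(2)] assms(1,3) Theorems_imp_MP[of \<phi> \<psi> \<chi>] by blast
next
  case (Rep \<psi> \<theta> \<theta>')
  \<comment> \<open>The premises lie in \<open>S \<inter> Theorems\<close>, so the conclusion is a
    theorem outright and \<phi> is added by weakening. The monotonicity rules and
    \<open>To_imp\<close> are treated the same way.\<close>
  then have "\<chi> \<in> Theorems" using Theorems_Rep[of \<psi> \<theta> \<theta>'] by blast
  then show ?thesis using assms by (simp add: Theorems_weaken)
next
  case (Bot_omega \<psi> \<beta>)
  \<comment> \<open>After uncurrying, the premises match the same rule with \<phi> conjoined to the
    side formula.\<close>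
  have "(\<phi> \<^bold>\<and> \<psi> \<^bold>\<rightarrow> PrNeq \<beta> \<epsilon>) \<in> Theorems" if "prob \<epsilon>" for \<epsilon>
    using S[OF Bot_omega(4)[OF that]] Bot_omega(2,3) that assms(1)
    by (simp add: Theorems_uncurry_iff)
  then have "(\<phi> \<^bold>\<and> \<psi> \<^bold>\<rightarrow> \<^bold>\<bottom>) \<in> Theorems"
    using Bot_omega(2,3) assms(1) by (intro Theorems_Bot_omega[of _ \<beta>]) auto
  then show ?thesis using Bot_omega(1,2) assms(1) by (simp add: Theorems_uncurry_iff)
next
  case (Mon_imp \<alpha> \<psi> \<chi>')
  then have "\<chi> \<in> Theorems" by (simp add: Theorems_Mon_imp)
  then show ?thesis using assms by (simp add: Theorems_weaken)
next
  case (To_imp \<alpha> \<psi>)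
  then have "\<chi> \<in> Theorems" by (simp add: Theorems_To_imp)
  then show ?thesis using assms by (simp add: Theorems_weaken)
next
  case (Imp_omega \<psi> \<alpha> \<beta> \<delta>)
  have "(\<phi> \<^bold>\<and> \<psi> \<^bold>\<rightarrow> (PrEq (\<alpha> \<^bold>\<and> \<beta>) (\<delta> * \<epsilon>) \<^bold>\<leftrightarrow> PrEq \<alpha> \<epsilon>)) \<in> Theorems"
    if "0 < \<epsilon>" "\<epsilon> \<le> 1" for \<epsilon>
  proof -
    \<comment> \<open>The product must be a probability for the premise to be in \<open>PCO\<close>,
      as uncurrying requires.\<close>
    have "prob (\<delta> * \<epsilon>)" using Imp_omega(5) that by (auto intro: mult_le_one)
    then show ?thesis
      using S[OF Imp_omega(6)[OF that]] Imp_omega(2-4) that assms(1)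
      by (simp add: Theorems_uncurry_iff)
  qed
  then have "(\<phi> \<^bold>\<and> \<psi> \<^bold>\<rightarrow> (\<alpha> \<^bold>\<supset> PrEq \<beta> \<delta>)) \<in> Theorems"
    using Imp_omega(2-5) assms(1) by (intro Theorems_Imp_omega) auto
  then show ?thesis using Imp_omega(1-5) assms(1) by (simp add: Theorems_uncurry_iff)
next
  case (Mon_cf xs \<psi> \<chi>')
  then have "\<chi> \<in> Theorems" by (simp add: Theorems_Mon_cf)
  then show ?thesis using assms by (simp add: Theorems_weaken)
qed

theorem deduction_theorem:
  assumes "PCO \<phi>" "{\<phi>} \<^bold>\<turnstile> \<chi>"
  shows "(\<phi> \<^bold>\<rightarrow> \<chi>) \<in> Theorems"
proof -
  obtain r f m where d: "derivation Theorems {\<phi>} r f" and m: "m \<in> Field r" "f m = \<chi>"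
    using assms(2) unfolding derives_def derivable_def by blast
  have entry: "PCO (f i)" "is_axiom (f i) \<or> f i = \<phi> \<or> step Theorems (f ` underS r i) (f i)"
    if "i \<in> Field r" for i
    using d that by (auto simp: derivation_def)
  \<comment> \<open>The strict part of the index order supports transfinite induction on the
    position of an entry.\<close>
  have "wf (r - Id)" using d by (auto simp: derivation_def order_on_defs)
  then have "i \<in> Field r \<Longrightarrow> (\<phi> \<^bold>\<rightarrow> f i) \<in> Theorems" for i
  proof (induction i rule: wf_induct_rule)
    case (less i)
    consider "is_axiom (f i)" | "f i = \<phi>" | "step Theorems (f ` underS r i) (f i)"
      using entry(2)[OF less.prems] by blast
    then show ?case
    proof cases
      case 1
      then show ?thesis
        using entry(1)[OF less.prems] assms(1) by (simp add: Theorems_weaken Theorems_axiom)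
    next
      case 2
      then show ?thesis using assms(1) by (simp add: Theorems_imp_refl)
    next
      case 3
      have "PCO \<psi> \<and> (\<phi> \<^bold>\<rightarrow> \<psi>) \<in> Theorems" if "\<psi> \<in> f ` underS r i" for \<psi>
        using that less.IH entry(1) by (auto simp: underS_def Field_def)
      with 3 show ?thesis
        using entry(1)[OF less.prems] assms(1) by (intro imp_Theorems_step)
    qed
  qed
  with m show ?thesis by auto
qed

section \<open>Transfer to probabilities\<close>

text \<open>By P1 the theorem \<open>\<alpha> \<supset> \<beta>\<close> has probability 1 provably,
  which is the antecedent of P6b.\<close>

lemma Theorems_imp_PrGe:
  assumes "CO \<alpha>" "CO \<beta>" "(\<alpha> \<^bold>\<supset> \<beta>) \<in> Theorems" "prob \<epsilon>"
  shows "(PrEq \<alpha> \<epsilon> \<^bold>\<rightarrow> PrGe \<beta> \<epsilon>) \<in> Theorems"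
proof -
  have PCO: "PCO (\<alpha> \<^bold>\<supset> \<beta>)" "PCO (PrEq (\<alpha> \<^bold>\<supset> \<beta>) 1)" "PCO (PrEq \<alpha> \<epsilon> \<^bold>\<rightarrow> PrGe \<beta> \<epsilon>)"
    using assms by (simp_all add: CO_imp_PCO)
  have "((\<alpha> \<^bold>\<supset> \<beta>) \<^bold>\<leftrightarrow> PrEq (\<alpha> \<^bold>\<supset> \<beta>) 1) \<in> Theorems"
    using assms PCO by (intro Theorems_axiom P1) auto
  then have "PrEq (\<alpha> \<^bold>\<supset> \<beta>) 1 \<in> Theorems"
    using assms(3) PCO(1,2) by (rule Theorems_iffD1)
  moreover have "(PrEq (\<alpha> \<^bold>\<supset> \<beta>) 1 \<^bold>\<rightarrow> (PrEq \<alpha> \<epsilon> \<^bold>\<rightarrow> PrGe \<beta> \<epsilon>)) \<in> Theorems"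
    using assms PCO by (intro Theorems_axiom P6b PCO_imp) auto
  ultimately show ?thesis using PCO(3) by (rule Theorems_MP)
qed

end

theorem mainTheorem4:
  fixes Dom :: "'v list" and Ran :: "'v \<Rightarrow> 'c list" and X\<^sub>0 :: 'v and x\<^sub>0 :: 'c
    and \<alpha> \<eta> :: "('v, 'c) fm"
  assumes "signature Dom Ran X\<^sub>0 x\<^sub>0"
    and "signature.CO Dom Ran \<alpha>"
    and "signature.PCO Dom Ran \<eta>"
    and "signature.derives Dom Ran X\<^sub>0 x\<^sub>0 {\<alpha>} \<eta>"
  shows "signature.derives Dom Ran X\<^sub>0 x\<^sub>0 {} (\<alpha> \<^bold>\<supset> \<eta>) \<and>
    (signature.CO Dom Ran \<eta> \<longrightarrow>
      (\<forall>\<epsilon>. 0 \<le> \<epsilon> \<and> \<epsilon> \<le> 1 \<longrightarrow>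
        signature.derives Dom Ran X\<^sub>0 x\<^sub>0 {}
          (signature.imp X\<^sub>0 x\<^sub>0 (signature.PrEq X\<^sub>0 x\<^sub>0 \<alpha> \<epsilon>) (PrGe \<eta> \<epsilon>))))"
proof -
  interpret signature Dom Ran X\<^sub>0 x\<^sub>0 by fact
  have "(\<alpha> \<^bold>\<rightarrow> \<eta>) \<in> Theorems"
    using assms(2,4) by (intro deduction_theorem CO_imp_PCO)
  \<comment> \<open>The rule applies only to a theorem whose antecedent is in \<open>CO\<close>: the
    deduction theorem supplies the former, the assumption on \<alpha> the latter.\<close>
  then have "(\<alpha> \<^bold>\<supset> \<eta>) \<in> Theorems"
    using assms(2,3) by (intro Theorems_To_imp)
  then show ?thesis
    using assms(2) by (auto simp: derives_empty_iff intro: Theorems_imp_PrGe)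
qed

end
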